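(* There does not exist a transformation that takes a robust local algorithm with query complexity $q$ and transforms it into a sample-based local algorithm (for the same function) with sample complexity at most $n^{1-1/o(q)}$.
   Context: A $q$-local algorithm for a partial function $f: Z\times\Sigma^n\to\{0,1\}$ receives explicit $z\in Z$ and query access to $x\in\Sigma^n$, makes at most $q$ queries, and outputs $f(z,x)$ with probability at least $2/3$ on the domain of $f$. It is $\rho$-robust at $x$ if it outputs $f(z,x)$ with probability at least $2/3$ on every $w$ within relative Hamming distance $\rho$ of $x$; it is $(\rho_0,\rho_1)$-robust if it is $\rho_b$-robust at every $x$ with $f(z,x)=b$; it is robust if it is $(\rho_0,\rho_1)$-robust with $\max\{\rho_0,\rho_1\}=\Omega(1)$. A sample-based algorithm queries each coordinate independently with some fixed probability; its sample complexity is the number of coordinates sampled. *)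

theory Defs
  imports "HOL-Probability.Probability" "HOL-Library.Landau_Symbols"
begin

text \<open>
  Inputs \<open>x \<in> \<Sigma>^n\<close> are the extensional functions in \<open>{..<n} \<rightarrow>\<^sub>E \<Sigma>\<close>. A partial function
  \<open>f: Z \<times> \<Sigma>^n \<rightarrow> {0,1}\<close> is a map into \<open>bool option\<close> (\<open>False\<close> is 0, \<open>True\<close> is 1, \<open>None\<close> is
  undefined); only its values at \<open>z \<in> Z\<close> and \<open>x \<in> \<Sigma>^n\<close> are ever used.
\<close>

type_synonym ('z, 'a) partial_fun = "'z \<Rightarrow> (nat \<Rightarrow> 'a) \<Rightarrow> bool option"

definition rel_hamming :: "nat \<Rightarrow> (nat \<Rightarrow> 'a) \<Rightarrow> (nat \<Rightarrow> 'a) \<Rightarrow> real" where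
  "rel_hamming n x w = real (card {i. i < n \<and> x i \<noteq> w i}) / real n"

text \<open>
  An adaptive query algorithm with a fixed random string is a decision tree; a randomised one is
  a distribution over decision trees, which may depend arbitrarily on the explicit input.
\<close>

datatype 'a dtree = Answer bool | Query nat "'a \<Rightarrow> 'a dtree"

primrec dtree_eval :: "'a dtree \<Rightarrow> (nat \<Rightarrow> 'a) \<Rightarrow> bool" where
  "dtree_eval (Answer b) x = b"
| "dtree_eval (Query i k) x = dtree_eval (k (x i)) x"

primrec dtree_queries :: "'a dtree \<Rightarrow> (nat \<Rightarrow> 'a) \<Rightarrow> nat list" where
  "dtree_queries (Answer b) x = []"
| "dtree_queries (Query i k) x = i # dtree_queries (k (x i)) x"

type_synonym ('z, 'a) query_alg = "'z \<Rightarrow> 'a dtree pmf"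

definition query_output :: "('z, 'a) query_alg \<Rightarrow> 'z \<Rightarrow> (nat \<Rightarrow> 'a) \<Rightarrow> bool pmf" where
  "query_output M z x = map_pmf (\<lambda>t. dtree_eval t x) (M z)"

definition local_algorithm ::
  "nat \<Rightarrow> nat \<Rightarrow> 'a set \<Rightarrow> 'z set \<Rightarrow> ('z, 'a) partial_fun \<Rightarrow> ('z, 'a) query_alg \<Rightarrow> bool" where
  "local_algorithm q n \<Sigma> Z f M \<longleftrightarrow>
     (\<forall>z\<in>Z. \<forall>x \<in> {..<n} \<rightarrow>\<^sub>E \<Sigma>.
        (\<forall>t \<in> set_pmf (M z).
           set (dtree_queries t x) \<subseteq> {..<n} \<and> length (dtree_queries t x) \<le> q) \<and>
        (\<forall>b. f z x = Some b \<longrightarrow> pmf (query_output M z x) b \<ge> 2 / 3))"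

definition robust_at ::
  "nat \<Rightarrow> 'a set \<Rightarrow> ('z, 'a) partial_fun \<Rightarrow> ('z, 'a) query_alg \<Rightarrow> real \<Rightarrow> 'z \<Rightarrow> (nat \<Rightarrow> 'a) \<Rightarrow> bool" where
  "robust_at n \<Sigma> f M \<rho> z x \<longleftrightarrow>
     (\<forall>w \<in> {..<n} \<rightarrow>\<^sub>E \<Sigma>. rel_hamming n x w \<le> \<rho> \<longrightarrow>
        pmf (query_output M z w) (the (f z x)) \<ge> 2 / 3)"

definition robust ::
  "nat \<Rightarrow> 'a set \<Rightarrow> 'z set \<Rightarrow> ('z, 'a) partial_fun \<Rightarrow> ('z, 'a) query_alg \<Rightarrow> real \<Rightarrow> real \<Rightarrow> bool" where
  "robust n \<Sigma> Z f M \<rho>0 \<rho>1 \<longleftrightarrow>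
     0 \<le> \<rho>0 \<and> 0 \<le> \<rho>1 \<and>
     (\<forall>z\<in>Z. \<forall>x \<in> {..<n} \<rightarrow>\<^sub>E \<Sigma>.
        (f z x = Some False \<longrightarrow> robust_at n \<Sigma> f M \<rho>0 z x) \<and>
        (f z x = Some True \<longrightarrow> robust_at n \<Sigma> f M \<rho>1 z x))"

text \<open>
  A sample-based algorithm sees the explicit input, the sampled set of coordinates and the
  restriction of \<open>x\<close> to that set; its decision may use further randomness.
\<close>

record ('z, 'a) sample_alg =
  sample_prob :: real
  decide :: "'z \<Rightarrow> nat set \<Rightarrow> (nat \<Rightarrow> 'a) \<Rightarrow> bool pmf"

definition sample_pmf :: "nat \<Rightarrow> real \<Rightarrow> nat set pmf" where
  "sample_pmf n p =
     map_pmf (\<lambda>h. {i. i < n \<and> h i}) (Pi_pmf {..<n} False (\<lambda>_. bernoulli_pmf p))"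

definition sample_output :: "nat \<Rightarrow> ('z, 'a) sample_alg \<Rightarrow> 'z \<Rightarrow> (nat \<Rightarrow> 'a) \<Rightarrow> bool pmf" where
  "sample_output n S z x =
     bind_pmf (sample_pmf n (sample_prob S)) (\<lambda>I. decide S z I (restrict x I))"

definition sample_based_algorithm ::
  "nat \<Rightarrow> 'a set \<Rightarrow> 'z set \<Rightarrow> ('z, 'a) partial_fun \<Rightarrow> ('z, 'a) sample_alg \<Rightarrow> bool" where
  "sample_based_algorithm n \<Sigma> Z f S \<longleftrightarrow>
     0 \<le> sample_prob S \<and> sample_prob S \<le> 1 \<and>
     (\<forall>z\<in>Z. \<forall>x \<in> {..<n} \<rightarrow>\<^sub>E \<Sigma>. \<forall>b. f z x = Some b \<longrightarrow> pmf (sample_output n S z x) b \<ge> 2 / 3)"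

text \<open>
  The number of sampled coordinates is a binomial random variable, so its size is measured by the
  expectation.
\<close>

definition sample_complexity :: "nat \<Rightarrow> ('z, 'a) sample_alg \<Rightarrow> real" where
  "sample_complexity n S =
     measure_pmf.expectation (sample_pmf n (sample_prob S)) (\<lambda>I. real (card I))"

text \<open>
  A transformation maps an algorithm, together with all parameters of the problem it solves, to a
  sample-based algorithm; no computability is asked for. In \<open>transforms_within \<rho> g T\<close>, every
  robust local algorithm whose larger robustness parameter is at least \<open>\<rho>\<close> is turned into a
  sample-based one for the same function with complexity at most \<open>n^(1 - 1/g(q))\<close>. Since the
  bounds are asymptotic, \<open>T\<close> only has to work for all large \<open>q\<close> and, for each \<open>q\<close> and each
  alphabet, for all large \<open>n\<close>; the bound on \<open>n\<close> is uniform in \<open>Z\<close>, \<open>f\<close> and the algorithm.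
  Alphabet and explicit inputs are coded by natural numbers.
\<close>

type_synonym transformation =
  "nat \<Rightarrow> nat \<Rightarrow> nat set \<Rightarrow> nat set \<Rightarrow> (nat, nat) partial_fun \<Rightarrow>
   (nat, nat) query_alg \<Rightarrow> (nat, nat) sample_alg"

definition transforms_within :: "real \<Rightarrow> (nat \<Rightarrow> real) \<Rightarrow> transformation \<Rightarrow> bool" where
  "transforms_within \<rho> g T \<longleftrightarrow>
     (\<forall>\<^sub>F q in sequentially. \<forall>\<Sigma>. finite \<Sigma> \<and> \<Sigma> \<noteq> {} \<longrightarrow>
       (\<forall>\<^sub>F n in sequentially. \<forall>Z f M \<rho>0 \<rho>1.
          local_algorithm q n \<Sigma> Z f M \<and> robust n \<Sigma> Z f M \<rho>0 \<rho>1 \<and> max \<rho>0 \<rho>1 \<ge> \<rho> \<longrightarrow>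
          sample_based_algorithm n \<Sigma> Z f (T q n \<Sigma> Z f M) \<and>
          sample_complexity n (T q n \<Sigma> Z f M) \<le> real n powr (1 - 1 / g q)))"

end

theory Submission
  imports Defs "HOL-Computational_Algebra.Polynomial" "HOL-Number_Theory.Cong"
begin

text \<open>
  Cut the input into \<open>b\<close> blocks of length \<open>q = 2 * m\<close> over a prime field of size at least \<open>q\<close>.
  On negative inputs every block evaluates a polynomial of degree less than \<open>m\<close>, on positive
  inputs one that is monic of degree \<open>m\<close>. Two such words agree in at most \<open>m\<close> places, so reading
  one random block is a \<open>q\<close>-query algorithm that is robust at radius \<open>1 / 6\<close>, independently of \<open>q\<close>.
  On the other hand, a set of coordinates that meets every block in at most \<open>m\<close> places carries no
  information: adding to each block a monic polynomial of degree \<open>m\<close> that vanishes on the set maps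
  the negative inputs bijectively to the positive ones without changing the sampled values. A
  sample-based algorithm must therefore hit some block at least \<open>m\<close> times, which happens with
  probability at most \<open>b * 2 ^ q * p ^ m\<close> if the coordinates are sampled with probability \<open>p\<close>.
  This forces sample complexity \<open>n^(1 - O(1/q))\<close>.
\<close>

section \<open>Polynomials modulo a prime\<close>

text \<open>Lagrange's bound, by induction: synthetic division over the integers splits off a root
  \<open>a\<close>, the remainder \<open>poly h a\<close> is divisible by \<open>p\<close>, and
  primality sends every other root to the quotient. Monic polynomials are used because the quotient
  is monic again and the degree cannot drop modulo \<open>p\<close>.\<close>

lemma card_roots_mod_prime_le_degree:
  fixes h :: "int poly"
  assumes "prime p" "lead_coeff h = 1"
  shows "card {i. i < p \<and> int p dvd poly h (int i)} \<le> degree h"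
  using assms(2)
proof (induction "degree h" arbitrary: h)
  case 0
  then have "h = 1"
    by (metis degree_eq_zeroE degree_pCons_0 lead_coeff_pCons(2) one_pCons)
  then have "{i. i < p \<and> int p dvd poly h (int i)} = {}"
    using assms(1) prime_gt_1_nat[of p] by auto
  then show ?case by (metis card.empty le0)
next
  case (Suc d)
  let ?R = "\<lambda>h. {i. i < p \<and> int p dvd poly h (int i)}"
  show ?case
  proof (cases "?R h = {}")
    case False
    then obtain a where a: "a < p" "int p dvd poly h (int a)" by auto
    define g where "g = synthetic_div h (int a)"
    have h: "h = [:- int a, 1:] * g + [:poly h (int a):]"
      using synthetic_div_correct'[of "int a" h] by (simp add: g_def)
    have deg: "degree g = d"
      using Suc(2) by (simp add: g_def degree_synthetic_div)
    have "coeff h (Suc d) = coeff g d"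
      by (subst h) (use deg in \<open>simp add: coeff_pCons coeff_eq_0 split: nat.split\<close>)
    then have lead: "lead_coeff g = 1"
      using Suc deg by simp
    have "?R h \<subseteq> insert a (?R g)"
    proof
      fix i assume i: "i \<in> ?R h"
      have "poly h (int i) = (int i - int a) * poly g (int i) + poly h (int a)"
        by (subst h) (simp add: algebra_simps)
      with i a have "int p dvd (int i - int a) * poly g (int i)"
        by (metis (no_types, lifting) dvd_add_left_iff mem_Collect_eq)
      then consider "int p dvd (int i - int a)" | "int p dvd poly g (int i)"
        using assms(1) prime_dvd_mult_iff[of "int p"] by auto
      then show "i \<in> insert a (?R g)"
      proof cases
        case 1
        then have "int i mod int p = int a mod int p"
          by (simp add: mod_eq_dvd_iff)
        then show ?thesis using i a by simp
      qed (use i in auto)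
    qed
    then have "card (?R h) \<le> card (insert a (?R g))"
      by (intro card_mono) auto
    also have "\<dots> \<le> Suc (card (?R g))"
      by (simp add: card_insert_if)
    also have "\<dots> \<le> Suc d"
      using Suc(1)[of g] deg lead by simp
    finally show ?thesis using Suc(2) by simp
  next
    case True
    then show ?thesis by (simp only: card.empty)
  qed
qed

text \<open>The power of X pads the product of linear factors, so that the degree is exactly
  \<open>m\<close> for every \<open>J\<close> with at most \<open>m\<close> elements.\<close>

definition vanishing_poly :: "nat \<Rightarrow> nat set \<Rightarrow> int poly" where
  "vanishing_poly m J = monom 1 (m - card J) * (\<Prod>a\<in>J. [:- int a, 1:])"

lemma poly_vanishing_poly [simp]: "finite J \<Longrightarrow> a \<in> J \<Longrightarrow> poly (vanishing_poly m J) (int a) = 0"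
  by (auto simp: vanishing_poly_def poly_prod)

text \<open>The padded product is monic of degree \<open>m\<close>, so the leading terms cancel. The
  difference is the low-degree part that a shift of a coset by X^m may carry.\<close>

lemma degree_vanishing_poly_diff:
  assumes "card J \<le> m" "0 < m"
  shows "degree (vanishing_poly m J - monom 1 m) < m"
proof -
  let ?Q = "\<Prod>a\<in>J. [:- int a, 1:]"
  have "degree ?Q = card J"
    by (simp add: degree_prod_eq_sum_degree)
  moreover have "lead_coeff ?Q = 1"
    by (simp only: lead_coeff_prod) simp
  ultimately have Q: "degree ?Q = card J" "lead_coeff ?Q = 1" .
  have Q0: "?Q \<noteq> 0" using Q(2) by fastforce
  have "degree (vanishing_poly m J) = m"
    using assms(1) Q Q0 by (simp add: vanishing_poly_def degree_mult_eq monom_eq_0_iff degree_monom_eq)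
  moreover have "lead_coeff (vanishing_poly m J) = 1"
    unfolding vanishing_poly_def lead_coeff_mult using Q(2) by (simp add: degree_monom_eq)
  ultimately show ?thesis
    using assms(2) by (intro degree_lessI) (auto simp: coeff_eq_0)
qed

section \<open>Indistinguishability under sampling\<close>

lemma set_sample_pmf: "set_pmf (sample_pmf n p) \<subseteq> Pow {..<n}"
  by (auto simp: sample_pmf_def)

lemma finite_set_sample_pmf [simp]: "finite (set_pmf (sample_pmf n p))"
  by (rule finite_subset[OF set_sample_pmf]) simp

lemma prob_sample_superset:
  assumes "0 \<le> p" "p \<le> 1" "J \<subseteq> {..<n}"
  shows "measure_pmf.prob (sample_pmf n p) {I. J \<subseteq> I} = p ^ card J"
proof -
  let ?P = "Pi_pmf {..<n} False (\<lambda>_. bernoulli_pmf p)"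
  have "measure_pmf.prob (sample_pmf n p) {I. J \<subseteq> I} = measure_pmf.prob ?P {h. J \<subseteq> {i. i < n \<and> h i}}"
    by (simp add: sample_pmf_def vimage_def)
  \<comment> \<open>Containing \<open>J\<close> is a product event that leaves the coordinates
    outside \<open>J\<close> free, so independence applies.\<close>
  also have "{h. J \<subseteq> {i. i < n \<and> h i}} = Pi {..<n} (\<lambda>i. if i \<in> J then {True} else UNIV)"
    using assms(3) by (fastforce simp: Pi_def split: if_splits)
  also have "measure_pmf.prob ?P \<dots>
      = (\<Prod>i<n. measure_pmf.prob (bernoulli_pmf p) (if i \<in> J then {True} else UNIV))"
    by (rule measure_Pi_pmf_Pi) simp
  also have "\<dots> = (\<Prod>i<n. if i \<in> J then p else 1)"
    using assms by (intro prod.cong) (auto simp: measure_pmf_single)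
  also have "\<dots> = p ^ card J"
    using assms(3) by (simp add: prod.If_cases Int_absorb1)
  finally show ?thesis .
qed

lemma sample_complexity_eq:
  assumes "0 \<le> sample_prob S" "sample_prob S \<le> 1"
  shows "sample_complexity n S = real n * sample_prob S"
proof -
  let ?N = "sample_pmf n (sample_prob S)"
  \<comment> \<open>Linearity of expectation; the indicators are phrased as supersets of singletons
    to fit \<open>prob_sample_superset\<close>.\<close>
  have "sample_complexity n S = measure_pmf.expectation ?N (\<lambda>I. \<Sum>i<n. indicator {I. {i} \<subseteq> I} I)"
    unfolding sample_complexity_def
  proof (rule integral_cong_AE; (simp add: AE_measure_pmf_iff)?; safe?)
    fix I assume "I \<in> set_pmf ?N"
    then have "I \<subseteq> {..<n}" using set_sample_pmf by blast
    then show "real (card I) = (\<Sum>i<n. indicator {I. i \<in> I} I)"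
      by (simp add: indicator_def sum.If_cases Int_absorb1)
  qed
  also have "\<dots> = (\<Sum>i<n. measure_pmf.prob ?N {I. {i} \<subseteq> I})"
    by (subst Bochner_Integration.integral_sum) (auto intro: integrable_measure_pmf_finite)
  also have "\<dots> = (\<Sum>i<n. sample_prob S)"
    by (intro sum.cong refl, subst prob_sample_superset) (use assms in auto)
  finally show ?thesis by simp
qed

text \<open>Average over uniform inputs from \<open>F0\<close> and from \<open>F1\<close>.
  Correctness forces a gap of at least 1/3 between the acceptance probabilities. A sample outside
  \<open>bad\<close> contributes nothing to the gap, since its bijection matches inputs that look
  alike on it, and a sample in \<open>bad\<close> contributes at most 1.\<close>

lemma prob_uninformative_sample:
  assumes S: "sample_based_algorithm n \<Sigma> Z f S" and "z \<in> Z"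
    and F0: "F0 \<subseteq> {..<n} \<rightarrow>\<^sub>E \<Sigma>" "\<And>x. x \<in> F0 \<Longrightarrow> f z x = Some False"
    and F1: "F1 \<subseteq> {..<n} \<rightarrow>\<^sub>E \<Sigma>" "\<And>x. x \<in> F1 \<Longrightarrow> f z x = Some True"
    and fin: "finite F0" "F0 \<noteq> {}" "card F0 = card F1"
    and bij: "\<And>I. I \<subseteq> {..<n} \<Longrightarrow> I \<notin> bad \<Longrightarrow>
      \<exists>\<phi>. bij_betw \<phi> F0 F1 \<and> (\<forall>x\<in>F0. restrict (\<phi> x) I = restrict x I)"
  shows "measure_pmf.prob (sample_pmf n (sample_prob S)) bad \<ge> 1 / 3"
proof -
  let ?N = "sample_pmf n (sample_prob S)"
  define d where "d = (\<lambda>I x. pmf (decide S z I (restrict x I)) True)"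
  have out: "pmf (sample_output n S z x) True = measure_pmf.expectation ?N (\<lambda>I. d I x)" for x
    by (simp add: sample_output_def pmf_bind d_def)
  have card0: "card F0 > 0" using fin(1,2) by (simp add: card_gt_0_iff)
  have hi: "pmf (sample_output n S z x) True \<ge> 2 / 3" if "x \<in> F1" for x
    using S \<open>z \<in> Z\<close> F1 that by (auto simp: sample_based_algorithm_def)
  have "pmf (sample_output n S z x) False \<ge> 2 / 3" if "x \<in> F0" for x
    using S \<open>z \<in> Z\<close> F0 that by (auto simp: sample_based_algorithm_def)
  then have lo: "pmf (sample_output n S z x) True \<le> 1 / 3" if "x \<in> F0" for x
    using that pmf_False_conv_True[of "sample_output n S z x"] by force
  have "card F0 / 3 = card F1 * (2 / 3) - card F0 * (1 / 3)"
    by (simp add: fin(3))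
  also have "\<dots> \<le> (\<Sum>x\<in>F1. pmf (sample_output n S z x) True) - (\<Sum>x\<in>F0. pmf (sample_output n S z x) True)"
    using hi lo by (intro diff_mono sum_bounded_below sum_bounded_above) auto
  \<comment> \<open>With the sums inside the expectation, the two families are compared for each
    fixed \<open>I\<close>, so the bijection may depend on \<open>I\<close>.\<close>
  also have "\<dots> = measure_pmf.expectation ?N (\<lambda>I. (\<Sum>x\<in>F1. d I x) - (\<Sum>x\<in>F0. d I x))"
    unfolding out by (simp add: integrable_measure_pmf_finite)
  also have "\<dots> \<le> measure_pmf.expectation ?N (\<lambda>I. real (card F0) * indicator bad I)"
  proof (rule integral_mono_AE)
    show "AE I in ?N. (\<Sum>x\<in>F1. d I x) - (\<Sum>x\<in>F0. d I x) \<le> real (card F0) * indicator bad I"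
      unfolding AE_measure_pmf_iff
    proof
      fix I assume "I \<in> set_pmf ?N"
      then have I: "I \<subseteq> {..<n}" using set_sample_pmf by blast
      show "(\<Sum>x\<in>F1. d I x) - (\<Sum>x\<in>F0. d I x) \<le> real (card F0) * indicator bad I"
      proof (cases "I \<in> bad")
        case True
        have "(\<Sum>x\<in>F1. d I x) \<le> real (card F1) * 1"
          by (rule sum_bounded_above) (simp add: d_def pmf_le_1)
        moreover have "(\<Sum>x\<in>F0. d I x) \<ge> 0"
          by (rule sum_nonneg) (simp add: d_def)
        ultimately show ?thesis using True fin by simp
      next
        case False
        from bij[OF I this] obtain \<phi>
          where \<phi>: "bij_betw \<phi> F0 F1" "\<And>x. x \<in> F0 \<Longrightarrow> restrict (\<phi> x) I = restrict x I" by auto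
        have "(\<Sum>x\<in>F1. d I x) = (\<Sum>x\<in>F0. d I (\<phi> x))"
          using \<phi>(1) by (metis sum.reindex_bij_betw)
        also have "\<dots> = (\<Sum>x\<in>F0. d I x)"
          by (intro sum.cong) (simp_all add: d_def \<phi>)
        finally show ?thesis by simp
      qed
    qed
  qed (auto intro: integrable_measure_pmf_finite)
  also have "\<dots> = card F0 * measure_pmf.prob ?N bad" by simp
  finally show ?thesis using card0 by (simp add: field_simps)
qed

section \<open>Blockwise Reed--Solomon cosets\<close>

text \<open>With \<open>s = 1\<close> the Reed--Solomon code is shifted by the evaluation of \<open>X ^ m\<close>.\<close>

definition rs_coset :: "nat \<Rightarrow> nat \<Rightarrow> nat \<Rightarrow> int \<Rightarrow> (nat \<Rightarrow> nat) \<Rightarrow> bool" where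
  "rs_coset p k m s u \<longleftrightarrow> (\<exists>c. degree c < m \<and>
     (\<forall>i<k. [int (u i) = poly (monom s m + c) (int i)] (mod int p)))"

lemma rs_coset_cong: "(\<And>i. i < k \<Longrightarrow> u i = v i) \<Longrightarrow> rs_coset p k m s u = rs_coset p k m s v"
  by (simp add: rs_coset_def)

text \<open>Shifts add up. They are integers so that \<open>r = -1\<close> can undo
  \<open>r = 1\<close>.\<close>

lemma rs_coset_add:
  assumes "rs_coset p k m s u" "degree h < m"
    and "\<And>i. i < k \<Longrightarrow> [int (v i) = int (u i) + poly (monom r m + h) (int i)] (mod int p)"
  shows "rs_coset p k m (s + r) v"
proof -
  obtain c where c: "degree c < m" "\<And>i. i < k \<Longrightarrow> [int (u i) = poly (monom s m + c) (int i)] (mod int p)"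
    using assms(1) by (auto simp: rs_coset_def)
  have "[int (v i) = poly (monom (s + r) m + (c + h)) (int i)] (mod int p)" if "i < k" for i
  proof -
    have "[int (v i) = poly (monom s m + c) (int i) + poly (monom r m + h) (int i)] (mod int p)"
      using assms(3)[OF that] cong_add[OF c(2)[OF that] cong_refl] cong_trans by blast
    then show ?thesis by (simp add: add_monom[symmetric] algebra_simps)
  qed
  moreover have "degree (c + h) < m" using c assms(2) by (simp add: degree_add_less)
  ultimately show ?thesis unfolding rs_coset_def by blast
qed

text \<open>The difference of the two polynomials is monic of degree \<open>m\<close>, hence has at
  most \<open>m\<close> roots modulo \<open>p\<close>; since \<open>k \<le> p\<close>, distinct
  positions are distinct residues.\<close>

lemma rs_coset_distance:
  assumes "prime p" "k \<le> p" "rs_coset p k m 0 u" "rs_coset p k m 1 v"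
  shows "k - m \<le> card {i. i < k \<and> u i \<noteq> v i}"
proof -
  obtain c where c: "degree c < m" "\<And>i. i < k \<Longrightarrow> [int (u i) = poly c (int i)] (mod int p)"
    using assms(3) by (auto simp: rs_coset_def)
  obtain d where d: "degree d < m" "\<And>i. i < k \<Longrightarrow> [int (v i) = poly (monom 1 m + d) (int i)] (mod int p)"
    using assms(4) by (auto simp: rs_coset_def)
  define h where "h = monom 1 m + (d - c)"
  have dc: "degree (d - c) < m" using c(1) d(1) by (simp add: degree_diff_less)
  then have deg: "degree h = m"
    by (simp add: h_def degree_add_eq_left degree_monom_eq)
  have lead: "lead_coeff h = 1"
    unfolding deg using coeff_eq_0[OF dc] by (simp add: h_def)
  have "{i. i < k \<and> u i = v i} \<subseteq> {i. i < p \<and> int p dvd poly h (int i)}"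
  proof safe
    fix i assume i: "i < k" "u i = v i"
    show "i < p" using i assms(2) by simp
    have "[poly (monom 1 m + d) (int i) = poly c (int i)] (mod int p)"
      using c(2)[OF i(1)] d(2)[OF i(1)] i(2) by (metis cong_sym cong_trans)
    then show "int p dvd poly h (int i)"
      by (simp add: cong_iff_dvd_diff h_def algebra_simps)
  qed
  then have "card {i. i < k \<and> u i = v i} \<le> card {i. i < p \<and> int p dvd poly h (int i)}"
    by (intro card_mono) auto
  also have "\<dots> \<le> m"
    using card_roots_mod_prime_le_degree[OF assms(1) lead] deg by simp
  finally have "card {i. i < k \<and> u i = v i} \<le> m" .
  moreover have "card {i. i < k \<and> u i = v i} + card {i. i < k \<and> u i \<noteq> v i} = card {..<k}"
    by (subst card_Un_disjoint[symmetric]) (auto simp del: card_lessThan intro: arg_cong[where f = card])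
  ultimately show ?thesis by simp
qed

section \<open>Words made of blocks, and shifts between the two cosets\<close>

definition block :: "nat \<Rightarrow> nat \<Rightarrow> (nat \<Rightarrow> 'a) \<Rightarrow> nat \<Rightarrow> 'a" where
  "block k j x = (\<lambda>i. x (j * k + i))"

lemma block_index_less: "j < b \<Longrightarrow> i < k \<Longrightarrow> j * k + i < b * (k::nat)"
  by (metis add.commute add_less_cancel_right less_le_trans mult_Suc mult_le_mono1 Suc_leI)

definition rs_words :: "nat \<Rightarrow> nat \<Rightarrow> nat \<Rightarrow> nat \<Rightarrow> int \<Rightarrow> (nat \<Rightarrow> nat) set" where
  "rs_words p k m b s =
     {x \<in> {..<b * k} \<rightarrow>\<^sub>E {..<p}. \<forall>j<b. rs_coset p k m s (block k j x)}"

lemma finite_rs_words [simp]: "finite (rs_words p k m b s)"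
  by (rule finite_subset[of _ "{..<b * k} \<rightarrow>\<^sub>E {..<p}"]) (auto simp: rs_words_def intro: finite_PiE)

lemma rs_words_nonempty:
  assumes "0 < p" "0 < m"
  shows "rs_words p k m b 0 \<noteq> {}"
proof -
  have "restrict (\<lambda>_. 0) {..<b * k} \<in> rs_words p k m b 0"
    using assms block_index_less[of _ b _ k]
    by (auto simp: rs_words_def rs_coset_def block_def intro!: exI[of _ 0])
  then show ?thesis by blast
qed

text \<open>The shift \<open>H\<close> takes integer values, so that subtracting it is adding
  \<open>- H\<close>; reduction brings the result back into the alphabet.\<close>

definition add_mod :: "nat \<Rightarrow> nat \<Rightarrow> (nat \<Rightarrow> int) \<Rightarrow> (nat \<Rightarrow> nat) \<Rightarrow> nat \<Rightarrow> nat" where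
  "add_mod p n H x = (\<lambda>i\<in>{..<n}. nat ((int (x i) + H i) mod int p))"

lemma add_mod_inverse:
  assumes "x \<in> {..<n} \<rightarrow>\<^sub>E {..<p}" "\<And>i. G i = - H i"
  shows "add_mod p n G (add_mod p n H x) = x"
proof
  fix i
  show "add_mod p n G (add_mod p n H x) i = x i"
  proof (cases "i < n")
    case True
    then have "x i < p" using assms by auto
    then have "int ((add_mod p n G (add_mod p n H x)) i) = int (x i)"
      using True assms(2) by (simp add: add_mod_def mod_diff_left_eq)
    then show ?thesis by simp
  next
    case False
    then show ?thesis using assms by (auto simp: add_mod_def PiE_def extensional_def)
  qed
qed

lemma add_mod_rs_words:
  assumes x: "x \<in> rs_words p k m b s" and "0 < p"
    and "\<And>j. j < b \<Longrightarrow> degree (h j) < m"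
    and H: "\<And>j i. j < b \<Longrightarrow> i < k \<Longrightarrow> H (j * k + i) = poly (monom r m + h j) (int i)"
  shows "add_mod p (b * k) H x \<in> rs_words p k m b (s + r)"
  unfolding rs_words_def mem_Collect_eq
proof (intro conjI allI impI, goal_cases)
  case 1
  then show ?case using \<open>0 < p\<close> by (auto simp: add_mod_def nat_less_iff)
next
  case (2 j)
  have "rs_coset p k m s (block k j x)" using x 2 by (auto simp: rs_words_def)
  then show ?case
  proof (rule rs_coset_add[OF _ assms(3)[OF 2]])
    fix i assume "i < k"
    then show "[int (block k j (add_mod p (b * k) H x) i) =
        int (block k j x i) + poly (monom r m + h j) (int i)] (mod int p)"
      using 2 block_index_less[of j b i k] H[of j i] \<open>0 < p\<close>
      by (simp add: block_def add_mod_def cong_def)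
  qed
qed

lemma rs_words_bij:
  assumes "0 < p" "0 < m" "I \<subseteq> {..<b * k}"
    and small: "\<And>j. j < b \<Longrightarrow> card {i. i < k \<and> j * k + i \<in> I} \<le> m"
  shows "\<exists>\<phi>. bij_betw \<phi> (rs_words p k m b 0) (rs_words p k m b 1) \<and>
    (\<forall>x\<in>rs_words p k m b 0. restrict (\<phi> x) I = restrict x I)"
proof -
  \<comment> \<open>One polynomial per block, determined by \<open>I\<close> alone and not by the
    word, so the same shift can be subtracted again.\<close>
  define V where "V j = vanishing_poly m {i. i < k \<and> j * k + i \<in> I}" for j
  define H where "H i = poly (V (i div k)) (int (i mod k))" for i
  have deg: "degree (V j - monom 1 m) < m" if "j < b" for j
    unfolding V_def using degree_vanishing_poly_diff small[OF that] assms(2) by blast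
  \<comment> \<open>For the inverse: \<open>- V j\<close> is \<open>- X^m\<close> plus this
    difference, a shift by \<open>-1\<close>.\<close>
  have deg': "degree (monom 1 m - V j) < m" if "j < b" for j
    using deg[OF that] by (metis degree_minus minus_diff_eq)
  have H_block: "H (j * k + i) = poly (V j) (int i)" if "i < k" for i j
    using that by (simp add: H_def)
  \<comment> \<open>If \<open>k = 0\<close> there are no coordinates and \<open>I\<close> is
    empty.\<close>
  have H_I: "H i = 0" if "i \<in> I" for i
    using that assms(3) by (cases "k = 0") (auto simp: H_def V_def)
  have "add_mod p (b * k) H x \<in> rs_words p k m b 1" if "x \<in> rs_words p k m b 0" for x
    using add_mod_rs_words[OF that assms(1), of "\<lambda>j. V j - monom 1 m" H 1] deg H_block by simp
  moreover have "add_mod p (b * k) (\<lambda>i. - H i) x \<in> rs_words p k m b 0" if "x \<in> rs_words p k m b 1" for x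
    using add_mod_rs_words[OF that assms(1), of "\<lambda>j. monom 1 m - V j" "\<lambda>i. - H i" "-1"] deg' H_block
    by (simp add: minus_monom[symmetric])
  moreover have "add_mod p (b * k) G (add_mod p (b * k) F x) = x"
    if "x \<in> rs_words p k m b s" "\<And>i. G i = - F i" for x s F G
    using that by (intro add_mod_inverse) (auto simp: rs_words_def)
  ultimately have "bij_betw (add_mod p (b * k) H) (rs_words p k m b 0) (rs_words p k m b 1)"
    by (intro bij_betw_byWitness[where f' = "add_mod p (b * k) (\<lambda>i. - H i)"])
      (auto simp del: minus_apply)
  moreover have "restrict (add_mod p (b * k) H x) I = restrict x I" if "x \<in> rs_words p k m b 0" for x
  proof (rule restrict_ext)
    fix i assume i: "i \<in> I"
    then have "i < b * k" "x i < p" using assms(3) that by (auto simp: rs_words_def PiE_def Pi_def)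
    \<comment> \<open>The letter is already below \<open>p\<close>, so adding zero and reducing
      leaves it alone.\<close>
    then show "add_mod p (b * k) H x i = x i" by (simp add: add_mod_def H_I[OF i] zmod_int)
  qed
  ultimately show ?thesis by blast
qed

definition rs_fun :: "nat \<Rightarrow> nat \<Rightarrow> nat \<Rightarrow> nat \<Rightarrow> (nat, nat) partial_fun" where
  "rs_fun p k m b z x =
     (if x \<in> rs_words p k m b 1 then Some True
      else if x \<in> rs_words p k m b 0 then Some False else None)"

text \<open>Block 0 of a common word would differ from itself in at least \<open>k - m > 0\<close>
  places. Hence the order of the tests in \<open>rs_fun\<close> does not matter.\<close>

lemma rs_words_disjoint:
  assumes "prime p" "k \<le> p" "m < k" "0 < b" "x \<in> rs_words p k m b 0"
  shows "x \<notin> rs_words p k m b 1"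
proof
  assume "x \<in> rs_words p k m b 1"
  then show False
    using assms rs_coset_distance[OF assms(1,2), of m "block k 0 x" "block k 0 x"]
    by (auto simp: rs_words_def)
qed

section \<open>The block tester\<close>

text \<open>The nonadaptive decision tree; the continuation \<open>P\<close> accumulates the
  answers.\<close>

fun read_tree :: "nat list \<Rightarrow> ('a list \<Rightarrow> bool) \<Rightarrow> 'a dtree" where
  "read_tree [] P = Answer (P [])"
| "read_tree (i # is) P = Query i (\<lambda>a. read_tree is (\<lambda>l. P (a # l)))"

lemma dtree_eval_read_tree [simp]: "dtree_eval (read_tree is P) x = P (map x is)"
  by (induction "is" arbitrary: P) auto

lemma dtree_queries_read_tree [simp]: "dtree_queries (read_tree is P) x = is"
  by (induction "is" arbitrary: P) auto

text \<open>Testing for the positive coset only makes the error one-sided: positive inputs are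
  accepted with certainty, and robustness is sought on the negative side.\<close>

definition block_tester :: "nat \<Rightarrow> nat \<Rightarrow> nat \<Rightarrow> nat \<Rightarrow> (nat, nat) query_alg" where
  "block_tester p k m b z =
     map_pmf (\<lambda>j. read_tree (map (\<lambda>i. j * k + i) [0..<k]) (\<lambda>l. rs_coset p k m 1 (\<lambda>i. l ! i)))
       (pmf_of_set {..<b})"

lemma pmf_block_tester:
  assumes "0 < b"
  shows "pmf (query_output (block_tester p k m b) z x) a =
    real (card {j. j < b \<and> rs_coset p k m 1 (block k j x) = a}) / real b"
proof -
  \<comment> \<open>The answer list agrees with the block at indices below \<open>k\<close>, the
    only ones that \<open>rs_coset\<close> inspects.\<close>
  have "rs_coset p k m 1 (\<lambda>i. map x (map (\<lambda>i. j * k + i) [0..<k]) ! i) = rs_coset p k m 1 (block k j x)" for j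
    by (rule rs_coset_cong) (simp add: block_def)
  then have "query_output (block_tester p k m b) z x =
      map_pmf (\<lambda>j. rs_coset p k m 1 (block k j x)) (pmf_of_set {..<b})"
    by (simp add: query_output_def block_tester_def pmf.map_comp comp_def)
  then have "pmf (query_output (block_tester p k m b) z x) a =
      real (card ({..<b} \<inter> (\<lambda>j. rs_coset p k m 1 (block k j x)) -` {a})) / real b"
    using assms by (simp add: pmf_map measure_pmf_of_set lessThan_empty_iff)
  also have "{..<b} \<inter> (\<lambda>j. rs_coset p k m 1 (block k j x)) -` {a} =
      {j. j < b \<and> rs_coset p k m 1 (block k j x) = a}" by auto
  finally show ?thesis .
qed

lemma block_tester_accepts:
  assumes "0 < b" "x \<in> rs_words p k m b 1"
  shows "pmf (query_output (block_tester p k m b) z x) True = 1"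
proof -
  have "{j. j < b \<and> rs_coset p k m 1 (block k j x) = True} = {..<b}"
    using assms by (auto simp: rs_words_def)
  then show ?thesis using assms by (simp only: pmf_block_tester) simp
qed

text \<open>Division with remainder by \<open>k\<close> identifies coordinates with pairs of block
  and position. It turns Hamming distances of blocks into that of whole words.\<close>

lemma sum_card_blocks:
  fixes b k :: nat
  shows "(\<Sum>j<b. card {i. i < k \<and> P (j * k + i)}) = card {i. i < b * k \<and> P i}"
proof -
  have "(\<Sum>j<b. card {i. i < k \<and> P (j * k + i)}) = card (SIGMA j:{..<b}. {i. i < k \<and> P (j * k + i)})"
    by simp
  also have "\<dots> = card {i. i < b * k \<and> P i}"
  proof (cases "k = 0")
    case False
    then show ?thesis
      by (intro bij_betw_same_card[of "\<lambda>(j, i). j * k + i"]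
            bij_betw_byWitness[where f' = "\<lambda>i. (i div k, i mod k)"])
        (auto simp: block_index_less less_mult_imp_div_less)
  qed simp
  finally show ?thesis .
qed

text \<open>
  Turning a block of a negative input into a word of the positive coset takes \<open>m\<close> changes, so
  changing a sixth of the \<open>2 * m * b\<close> coordinates spoils at most a third of the blocks.
\<close>

lemma block_tester_rejects:
  assumes "prime p" "2 * m \<le> p" "0 < m" "0 < b" "x \<in> rs_words p (2 * m) m b 0"
    and dist: "rel_hamming (b * (2 * m)) x w \<le> 1 / 6"
  shows "pmf (query_output (block_tester p (2 * m) m b) z w) False \<ge> 2 / 3"
proof -
  let ?k = "2 * m"
  let ?C = "\<lambda>a. {j. j < b \<and> rs_coset p ?k m 1 (block ?k j w) = a}"
  have "m * card (?C True) = (\<Sum>j\<in>?C True. m)" by simp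
  also have "\<dots> \<le> (\<Sum>j\<in>?C True. card {i. i < ?k \<and> x (j * ?k + i) \<noteq> w (j * ?k + i)})"
  proof (rule sum_mono)
    fix j assume "j \<in> ?C True"
    then show "m \<le> card {i. i < ?k \<and> x (j * ?k + i) \<noteq> w (j * ?k + i)}"
      using assms(5) rs_coset_distance[OF assms(1,2), of m "block ?k j x" "block ?k j w"]
      by (auto simp: rs_words_def block_def)
  qed
  also have "\<dots> \<le> (\<Sum>j<b. card {i. i < ?k \<and> x (j * ?k + i) \<noteq> w (j * ?k + i)})"
    by (rule sum_mono2) auto
  also have "\<dots> = card {i. i < b * ?k \<and> x i \<noteq> w i}"
    by (rule sum_card_blocks)
  finally have "real (m * card (?C True)) \<le> real (card {i. i < b * ?k \<and> x i \<noteq> w i})"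
    by (rule of_nat_mono)
  also have "\<dots> \<le> real (b * ?k) / 6"
    using dist assms(3,4) by (simp add: rel_hamming_def field_simps)
  finally have "real m * real (card (?C True)) \<le> real m * (real b / 3)"
    by (simp add: mult.commute)
  then have "real (card (?C True)) \<le> real b / 3"
    using assms(3) by (subst (asm) mult_le_cancel_left_pos) auto
  moreover have "card (?C True) + card (?C False) = card {..<b}"
    by (subst card_Un_disjoint[symmetric]) (auto simp del: card_lessThan intro: arg_cong[where f = card])
  ultimately have "real (card (?C False)) \<ge> 2 / 3 * real b" by simp
  then show ?thesis
    using assms(4) by (simp only: pmf_block_tester[OF assms(4)]) (simp add: field_simps)
qed

text \<open>Correctness on negative inputs is the rejection bound at distance zero.\<close>

lemma local_algorithm_block_tester:
  assumes "prime p" "2 * m \<le> p" "0 < m" "0 < b"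
  shows "local_algorithm (2 * m) (b * (2 * m)) {..<p} Z (rs_fun p (2 * m) m b) (block_tester p (2 * m) m b)"
  unfolding local_algorithm_def
proof (intro ballI conjI allI impI, goal_cases)
  case (1 z x t)
  then obtain j where j: "j < b" "set (dtree_queries t x) = (\<lambda>i. j * (2 * m) + i) ` {..<2 * m}"
    using assms(4) by (auto simp: block_tester_def lessThan_empty_iff lessThan_atLeast0)
  show ?case
    unfolding j(2) by (intro image_subsetI) (simp only: lessThan_iff block_index_less[OF j(1)])
next
  case (2 z x t)
  from 2(3) show ?case
    using assms(4) by (auto simp: block_tester_def lessThan_empty_iff)
next
  case (3 z x a)
  from 3(3) consider "a" "x \<in> rs_words p (2 * m) m b 1" | "\<not> a" "x \<in> rs_words p (2 * m) m b 0"
    by (auto simp: rs_fun_def split: if_splits)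
  then show ?case
  proof cases
    case 1
    then show ?thesis using block_tester_accepts[OF assms(4), of x p "2 * m" m z] by simp
  next
    case 2
    then show ?thesis using block_tester_rejects[OF assms, of x x z] by (simp add: rel_hamming_def)
  qed
qed

text \<open>The maximum of the two radii is the constant 1/6, for every \<open>m\<close>. Radius 0
  on the positive side admits only the input itself, because inputs are extensional.\<close>

lemma robust_block_tester:
  assumes "prime p" "2 * m \<le> p" "0 < m" "0 < b"
  shows "robust (b * (2 * m)) {..<p} Z (rs_fun p (2 * m) m b) (block_tester p (2 * m) m b) (1 / 6) 0"
proof -
  have eq: "w = x" if "w \<in> {..<n} \<rightarrow>\<^sub>E A" "x \<in> {..<n} \<rightarrow>\<^sub>E A" "rel_hamming n x w \<le> 0" "0 < n"
    for w x :: "nat \<Rightarrow> nat" and n A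
  proof (rule PiE_ext[OF that(1,2)])
    have "card {i. i < n \<and> x i \<noteq> w i} = 0"
      using that(3,4) by (simp add: rel_hamming_def divide_le_0_iff)
    then show "w i = x i" if "i \<in> {..<n}" for i using that by auto
  qed
  show ?thesis
    unfolding robust_def robust_at_def
  proof (intro conjI ballI allI impI, goal_cases)
    case (3 z x w)
    then show ?case using block_tester_rejects[OF assms, of x w z]
      by (auto simp: rs_fun_def split: if_splits)
  next
    case (4 z x w)
    then have "w = x" using eq[of w "b * (2 * m)" "{..<p}" x] assms by simp
    then show ?case using 4 block_tester_accepts[OF assms(4), of x p "2 * m" m z]
      by (auto simp: rs_fun_def split: if_splits)
  qed auto
qed

section \<open>The sampling lower bound\<close>

text \<open>Union bound over all pairs of a block and an \<open>m\<close>-subset of its positions;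
  the factor \<open>2 ^ k\<close> counts all subsets of a block.\<close>

lemma sample_based_rs_fun_lower_bound:
  assumes "prime p" "k \<le> p" "0 < m" "m < k" "0 < b" "z \<in> Z"
    and S: "sample_based_algorithm (b * k) {..<p} Z (rs_fun p k m b) S"
  shows "1 / 3 \<le> real b * 2 ^ k * sample_prob S ^ m"
proof -
  let ?N = "sample_pmf (b * k) (sample_prob S)"
  define \<J> where "\<J> = {(j, J). j < b \<and> J \<subseteq> {..<k} \<and> card J = m}"
  define sh where "sh = (\<lambda>(j, J). (\<lambda>i. j * k + i) ` J)"
  \<comment> \<open>Outside \<open>bad\<close> every block contains fewer than \<open>m\<close>
    sampled positions, which is within what \<open>rs_words_bij\<close> allows.\<close>
  define bad where "bad = (\<Union>t\<in>\<J>. {I. sh t \<subseteq> I})"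
  have ps: "0 \<le> sample_prob S" "sample_prob S \<le> 1"
    using S by (auto simp: sample_based_algorithm_def)
  have p0: "0 < p" using assms(1) prime_gt_0_nat by blast
  have \<J>: "\<J> \<subseteq> {..<b} \<times> Pow {..<k}" by (auto simp: \<J>_def)
  then have fin\<J>: "finite \<J>" by (rule finite_subset) auto
  have "card \<J> \<le> card ({..<b} \<times> Pow {..<k})" using \<J> by (intro card_mono) auto
  then have "card \<J> \<le> b * 2 ^ k" by (simp add: card_cartesian_product card_Pow)
  then have card\<J>: "real (card \<J>) \<le> real b * 2 ^ k"
    by (metis of_nat_mono of_nat_mult of_nat_numeral of_nat_power)
  have bij: "\<exists>\<phi>. bij_betw \<phi> (rs_words p k m b 0) (rs_words p k m b 1) \<and>
    (\<forall>x\<in>rs_words p k m b 0. restrict (\<phi> x) I = restrict x I)"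
    if I: "I \<subseteq> {..<b * k}" "I \<notin> bad" for I
  proof (rule rs_words_bij[OF p0 assms(3) I(1)], rule ccontr)
    fix j assume j: "j < b" "\<not> card {i. i < k \<and> j * k + i \<in> I} \<le> m"
    then obtain J where "J \<subseteq> {i. i < k \<and> j * k + i \<in> I}" "card J = m"
      by (metis nat_le_linear obtain_subset_with_card_n)
    then have "(j, J) \<in> \<J>" "sh (j, J) \<subseteq> I" using j by (auto simp: \<J>_def sh_def)
    then show False using I(2) by (auto simp: bad_def)
  qed
  \<comment> \<open>The empty sample already yields a bijection, hence equal cardinalities.\<close>
  have "\<exists>\<phi>. bij_betw \<phi> (rs_words p k m b 0) (rs_words p k m b 1)"
    using rs_words_bij[OF p0 assms(3), of "{}" b k] by auto
  then have card_eq: "card (rs_words p k m b 0) = card (rs_words p k m b 1)"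
    using bij_betw_same_card by blast
  have "1 / 3 \<le> measure_pmf.prob ?N bad"
  proof (rule prob_uninformative_sample[OF S \<open>z \<in> Z\<close>, of "rs_words p k m b 0" "rs_words p k m b 1"])
    show "rs_words p k m b s \<subseteq> {..<b * k} \<rightarrow>\<^sub>E {..<p}" for s
      by (auto simp only: rs_words_def)
    then show "rs_words p k m b 1 \<subseteq> {..<b * k} \<rightarrow>\<^sub>E {..<p}" .
    show "rs_words p k m b 0 \<noteq> {}" using rs_words_nonempty[OF p0 assms(3)] .
  qed (use bij card_eq rs_words_disjoint[OF assms(1,2,4,5)] in \<open>simp_all add: rs_fun_def\<close>)
  also have "\<dots> \<le> (\<Sum>t\<in>\<J>. measure_pmf.prob ?N {I. sh t \<subseteq> I})"
    unfolding bad_def by (rule measure_UNION_le) (auto simp: fin\<J>)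
  also have "\<dots> = (\<Sum>t\<in>\<J>. sample_prob S ^ m)"
  proof (rule sum.cong[OF refl])
    fix t assume t: "t \<in> \<J>"
    then obtain j J where jJ: "t = (j, J)" "j < b" "J \<subseteq> {..<k}" "card J = m" by (auto simp: \<J>_def)
    then have "sh t \<subseteq> {..<b * k}" by (auto simp: sh_def intro!: block_index_less)
    moreover have "card (sh t) = m" using jJ by (simp add: sh_def card_image)
    ultimately show "measure_pmf.prob ?N {I. sh t \<subseteq> I} = sample_prob S ^ m"
      using prob_sample_superset[OF ps] by simp
  qed
  also have "\<dots> = real (card \<J>) * sample_prob S ^ m" by simp
  also have "\<dots> \<le> real b * 2 ^ k * sample_prob S ^ m"
    using card\<J> ps by (intro mult_right_mono) auto
  finally show ?thesis .
qed

text \<open>Complexity at most \<open>n powr (1 - 1 / \<gamma>)\<close> bounds the sampling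
  probability by \<open>n powr (- 1 / \<gamma>)\<close>. Its \<open>m\<close>-th power is then so
  small that the union bound falls below 1/3.\<close>

lemma rs_fun_no_cheap_sampling:
  assumes "prime p" "2 * m \<le> p" "0 < m" "6 * 4 ^ m \<le> b" "z \<in> Z"
    and S: "sample_based_algorithm (b * (2 * m)) {..<p} Z (rs_fun p (2 * m) m b) S"
    and \<gamma>: "0 < \<gamma>" "\<gamma> \<le> real m / 2"
  shows "sample_complexity (b * (2 * m)) S > real (b * (2 * m)) powr (1 - 1 / \<gamma>)"
proof (rule ccontr)
  let ?n = "real (b * (2 * m))"
  assume "\<not> ?thesis"
  moreover have ps: "0 \<le> sample_prob S" "sample_prob S \<le> 1"
    using S by (auto simp: sample_based_algorithm_def)
  moreover have "b > 0" using assms(4) by (metis gr0I le_0_eq mult_is_0 power_not_zero zero_neq_numeral)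
  then have n1: "?n \<ge> 1" "?n \<ge> real b"
    using assms(3) by (simp_all add: Suc_le_eq flip: of_nat_mult)
  ultimately have "?n * sample_prob S \<le> ?n * ?n powr (- 1 / \<gamma>)"
    by (simp add: sample_complexity_eq powr_diff powr_minus_divide)
  then have "sample_prob S \<le> ?n powr (- 1 / \<gamma>)"
    using n1 by (subst (asm) mult_le_cancel_left_pos) auto
  then have "sample_prob S ^ m \<le> (?n powr (- 1 / \<gamma>)) ^ m"
    using ps by (intro power_mono)
  also have "\<dots> = ?n powr (- (real m / \<gamma>))"
    using n1 by (subst powr_realpow[symmetric]) (auto simp: powr_powr simp del: of_nat_mult)
  \<comment> \<open>From \<open>\<gamma> \<le> m / 2\<close> the exponent
    \<open>m / \<gamma>\<close> is at least 2. One factor of \<open>b\<close> cancels the number of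
    blocks, the other beats \<open>4 ^ m\<close>.\<close>
  also have "\<dots> \<le> ?n powr (-2)"
    using n1 \<gamma> by (intro powr_mono) (auto simp: field_simps)
  also have "\<dots> = 1 / ?n ^ 2"
    using n1 by (simp add: powr_minus_divide)
  also have "\<dots> \<le> 1 / real b ^ 2"
    using n1 \<open>b > 0\<close> by (intro divide_left_mono power_mono) auto
  finally have "real b * 2 ^ (2 * m) * sample_prob S ^ m \<le> real b * 2 ^ (2 * m) * (1 / real b ^ 2)"
    by (intro mult_left_mono) auto
  also have "\<dots> = 4 ^ m / real b"
    using \<open>b > 0\<close> by (simp add: power_mult power2_eq_square)
  \<comment> \<open>The constant 6 in the bound on \<open>b\<close> is chosen to land strictly below
    1/3.\<close>
  also have "\<dots> \<le> 1 / 6"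
    using \<open>b > 0\<close> of_nat_mono[OF assms(4), where 'a = real] by (simp add: field_simps)
  finally show False
    using sample_based_rs_fun_lower_bound[OF assms(1,2,3) _ \<open>b > 0\<close> \<open>z \<in> Z\<close> S] assms(3) by simp
qed

section \<open>Choosing query complexity, alphabet and input length, in this order\<close>

theorem theorem7p12:
  "\<not> (\<exists>T :: real \<Rightarrow> transformation. \<forall>\<rho>>0. \<exists>g :: nat \<Rightarrow> real.
        (\<forall>q. g q > 0) \<and> g \<in> o(\<lambda>q. real q) \<and> transforms_within \<rho> g (T \<rho>))"
proof
  assume "\<exists>T :: real \<Rightarrow> transformation. \<forall>\<rho>>0. \<exists>g :: nat \<Rightarrow> real.
        (\<forall>q. g q > 0) \<and> g \<in> o(\<lambda>q. real q) \<and> transforms_within \<rho> g (T \<rho>)"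
  then obtain T :: "real \<Rightarrow> transformation" where
    T: "\<forall>\<rho>>0. \<exists>g. (\<forall>q. g q > 0) \<and> g \<in> o(\<lambda>q. real q) \<and> transforms_within \<rho> g (T \<rho>)"
    by blast
  then obtain g :: "nat \<Rightarrow> real" where
    g: "\<And>q. g q > 0" "g \<in> o(\<lambda>q. real q)" "transforms_within (1 / 6) g (T (1 / 6))"
    by (metis zero_less_divide_1_iff zero_less_numeral)
  \<comment> \<open>At \<open>q = 2 * m\<close> this is the bound
    \<open>\<gamma> \<le> m / 2\<close> of the previous lemma.\<close>
  have "\<forall>\<^sub>F q in sequentially. g q \<le> q / 4"
    using landau_o.smallD[OF g(2), of "1 / 4"] g(1) by (simp add: less_imp_le)
  then obtain q0 where q0: "\<And>q. q \<ge> q0 \<Longrightarrow> g q \<le> q / 4"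
    unfolding eventually_sequentially by blast
  define transforms_at where "transforms_at q \<Sigma> n \<longleftrightarrow> (\<forall>Z f M \<rho>0 \<rho>1.
      local_algorithm q n \<Sigma> Z f M \<and> robust n \<Sigma> Z f M \<rho>0 \<rho>1 \<and> max \<rho>0 \<rho>1 \<ge> 1 / 6 \<longrightarrow>
      sample_based_algorithm n \<Sigma> Z f (T (1 / 6) q n \<Sigma> Z f M) \<and>
      sample_complexity n (T (1 / 6) q n \<Sigma> Z f M) \<le> real n powr (1 - 1 / g q))" for q \<Sigma> n
  have "\<forall>\<^sub>F q in sequentially. \<forall>\<Sigma>. finite \<Sigma> \<and> \<Sigma> \<noteq> {} \<longrightarrow> eventually (transforms_at q \<Sigma>) sequentially"
    using g(3) unfolding transforms_within_def transforms_at_def .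
  from iffD1[OF eventually_sequentially this]
  obtain q1 where q1: "\<forall>q\<ge>q1. \<forall>\<Sigma>. finite \<Sigma> \<and> \<Sigma> \<noteq> {} \<longrightarrow> eventually (transforms_at q \<Sigma>) sequentially"
    by (elim exE)
  \<comment> \<open>Then \<open>2 * m\<close> exceeds both thresholds and \<open>m\<close> is
    positive.\<close>
  define m where "m = Suc (max q0 q1)"
  obtain p where p: "prime p" "2 * m \<le> p" using bigger_prime[of "2 * m"] by (metis less_imp_le)
  have "{..<p} \<noteq> {}" using p by (auto simp: lessThan_empty_iff m_def)
  then have "eventually (transforms_at (2 * m) {..<p}) sequentially"
    using q1 by (simp add: m_def)
  then obtain n0 where n0: "\<And>n. n \<ge> n0 \<Longrightarrow> transforms_at (2 * m) {..<p} n"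
    unfolding eventually_sequentially by blast
  \<comment> \<open>The threshold \<open>n0\<close> depends on \<open>m\<close> and
    \<open>p\<close>, which are fixed by now; the number of blocks can still grow past it.\<close>
  define b where "b = n0 + 6 * 4 ^ m"
  have b: "0 < b" "6 * 4 ^ m \<le> b" "n0 \<le> b * (2 * m)" "0 < m"
    by (auto simp: b_def m_def)
  let ?S = "T (1 / 6) (2 * m) (b * (2 * m)) {..<p} {0} (rs_fun p (2 * m) m b) (block_tester p (2 * m) m b)"
  have "sample_based_algorithm (b * (2 * m)) {..<p} {0} (rs_fun p (2 * m) m b) ?S \<and>
      sample_complexity (b * (2 * m)) ?S \<le> real (b * (2 * m)) powr (1 - 1 / g (2 * m))"
    using n0[OF b(3), unfolded transforms_at_def, rule_format, OF conjI[OF local_algorithm_block_tester[OF p b(4,1)]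
        conjI[OF robust_block_tester[OF p b(4,1)]]]] by simp
  moreover have "q0 \<le> 2 * m" by (simp add: m_def max_def)
  then have "g (2 * m) \<le> real m / 2" using q0[of "2 * m"] by simp
  ultimately show False
    using rs_fun_no_cheap_sampling[OF p b(4,2), of 0 "{0}"] g(1) by force
qed

end
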